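(* Let $\mu>0$, $s>0$, and let $\varphi:\mathbb{R}\to\mathbb{R}$ be strictly convex on $\mathbb{R}$, differentiable on $\mathbb{R}\setminus\{\mu\}$, with $\lim_{|x|\to\infty}|\varphi(x)/x|=\infty$, $\varphi(\mu)=0$, and global minimum attained at $\mu$. Let $0<r<\mu$. Then $$\sup_{\mathbb{P}\in\mathcal{P}(\mu,s,\varphi)}\frac{\mathrm{OPT}(\mathbb{P})}{\mathrm{REV}(r,\mathbb{P})}=\max\left\{\frac{1}{\inf_{\mathbb{P}\in\mathcal{P}(\mu,s,\varphi)}\mathbb{P}(X\ge r)},\ \frac{\sup_{\mathbb{P}\in\mathcal{P}(\mu,s,\varphi)}\mathbb{E}(X\mid X\ge r)}{r}\right\}.$$ The optimal (limiting) strategy for nature is to choose the unique two-point distribution in $\mathcal{P}(\mu,s,\varphi)$ supported on $v_1$ and $v_2$ with $v_1\to r^-$, so that $$\sup_{\mathbb{P}\in\mathcal{P}(\mu,s,\varphi)}\frac{\mathrm{OPT}(\mathbb{P})}{\mathrm{REV}(r,\mathbb{P})}=\max\left\{\frac{v_2-r}{\mu-r},\ \frac{v_2}{r}\right\},$$ where $v_2>\mu$ satisfies $$\frac{v_2-\mu}{v_2-r}\varphi(r)+\frac{\mu-r}{v_2-r}\varphi(v_2)=s.$$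
   Context: $\mathcal{P}(\mu,s,\varphi)$ is the set of all probability distributions $\mathbb{P}$ on $\mathbb{R}$ such that, for $X\sim\mathbb{P}$, $\mathbb{E}_{\mathbb{P}}(X)=\mu$ and $\mathbb{E}_{\mathbb{P}}(\varphi(X))=s$. For a price $r$ and a demand distribution $\mathbb{P}$, the expected revenue is $\mathrm{REV}(r,\mathbb{P})=r\,\mathbb{P}(X\ge r)$ with $X\sim\mathbb{P}$, and $\mathrm{OPT}(\mathbb{P})=\max_{r'}\mathrm{REV}(r',\mathbb{P})$ is the optimal revenue for the distribution $\mathbb{P}$. A two-point distribution is a distribution supported on two points $v_1<\mu<v_2$ with probability masses $w_1,w_2$. *)

theory Defs
  imports "HOL-Probability.Probability"
begin

definition strictly_convex_on :: "real set \<Rightarrow> (real \<Rightarrow> real) \<Rightarrow> bool" where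
  "strictly_convex_on S f \<longleftrightarrow> convex S \<and>
     (\<forall>x\<in>S. \<forall>y\<in>S. \<forall>t. x \<noteq> y \<and> 0 < t \<and> t < 1 \<longrightarrow>
        f ((1 - t) * x + t * y) < (1 - t) * f x + t * f y)"

text \<open>Integrability is demanded explicitly because the Bochner integral of a non-integrable
  function is 0 by convention.\<close>

definition ambiguity_set :: "real \<Rightarrow> real \<Rightarrow> (real \<Rightarrow> real) \<Rightarrow> real measure set" where
  "ambiguity_set \<mu> s \<phi> =
     {P. real_distribution P \<and>
         integrable P (\<lambda>x. x) \<and> (\<integral>x. x \<partial>P) = \<mu> \<and>
         integrable P \<phi> \<and> (\<integral>x. \<phi> x \<partial>P) = s}"

definition REV :: "real \<Rightarrow> real measure \<Rightarrow> real" where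
  "REV r P = r * measure P {r..}"

text \<open>A genuine maximum over all prices; lemma \<open>OPT_is_max\<close> below shows that it is attained whenever
  \<open>P\<close> has a positive mean, so \<open>GREATEST\<close> is meaningful on the distributions of interest.\<close>

definition OPT :: "real measure \<Rightarrow> real" where
  "OPT P = (GREATEST v. \<exists>r. v = REV r P)"

text \<open>\<open>\<E>(X | X \<ge> r)\<close>, conditioning on an event of positive probability.\<close>

definition cond_mean_above :: "real measure \<Rightarrow> real \<Rightarrow> real" where
  "cond_mean_above P r = (\<integral>x\<in>{r..}. x \<partial>P) / measure P {r..}"

definition two_point :: "real \<Rightarrow> real \<Rightarrow> real \<Rightarrow> real measure \<Rightarrow> bool" where
  "two_point \<mu> v1 v2 P \<longleftrightarrow> real_distribution P \<and> v1 < \<mu> \<and> \<mu> < v2 \<and>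
     (\<exists>w1>0. \<exists>w2>0. w1 + w2 = 1 \<and> measure P {v1} = w1 \<and> measure P {v2} = w2)"

lemma REV_attains_max:
  assumes "real_distribution P" and int: "integrable P (\<lambda>x. x)" and pos: "0 < (\<integral>x. x \<partial>P)"
  shows "\<exists>r. \<forall>r'. REV r' P \<le> REV r P"
proof -
  interpret real_distribution P by fact
  let ?p = "\<lambda>x. measure P {x..}"
  have meas [simp]: "borel_measurable P = (borel_measurable borel :: (real \<Rightarrow> real) set)"
    by (rule measurable_cong_sets) auto
  define g where "g = (\<lambda>x::real. \<integral>y. indicator {x..} y * \<bar>y\<bar> \<partial>P)"
  have lim: "(g \<longlongrightarrow> (\<integral>y. 0 \<partial>P)) at_top"
    unfolding g_def
  proof (rule integral_dominated_convergence_at_top[where w="\<lambda>y. \<bar>y\<bar>"])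
    show "\<forall>\<^sub>F i in at_top. AE x in P. norm (indicator {i..} x * \<bar>x\<bar>) \<le> \<bar>x\<bar>"
      by (auto simp: indicator_def)
    show "AE x in P. ((\<lambda>i. indicator {i..} x * \<bar>x\<bar>) \<longlongrightarrow> 0) at_top"
    proof (rule AE_I2)
      fix x :: real
      have "\<forall>\<^sub>F i in at_top. indicator {i..} x * \<bar>x\<bar> = (0::real)"
        using eventually_gt_at_top[of x] by eventually_elim auto
      then show "((\<lambda>i. indicator {i..} x * \<bar>x\<bar>) \<longlongrightarrow> 0) at_top"
        by (rule tendsto_eventually)
    qed
    show "integrable P (\<lambda>y. \<bar>y\<bar>)" using int by simp
  qed auto
  have bound: "REV x P \<le> g x" if "0 \<le> x" for x
  proof -
    have "REV x P = (\<integral>y. indicator {x..} y * x \<partial>P)" by (simp add: REV_def)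
    also have "\<dots> \<le> g x"
      unfolding g_def
    proof (rule integral_mono)
      show "integrable P (\<lambda>y. indicator {x..} y * \<bar>y\<bar>)"
        by (rule Bochner_Integration.integrable_bound[OF int]) (auto simp: indicator_def)
      show "integrable P (\<lambda>y. indicator {x..} y * x)"
        using that by (intro integrable_const_bound[where B=x]) (auto simp: indicator_def)
    qed (auto simp: indicator_def)
    finally show ?thesis .
  qed
  obtain x0 where x0: "0 < x0" "0 < REV x0 P"
  proof -
    have "\<exists>x0>0. 0 < ?p x0"
    proof (rule ccontr)
      assume "\<not> ?thesis"
      then have "?p (1 / real (Suc n)) = 0" for n
        using measure_nonneg[of P "{1 / real (Suc n)..}"] by (smt (verit) divide_pos_pos of_nat_0_less_iff zero_less_Suc zero_less_one)
      then have "AE x in P. x < 1 / real (Suc n)" for n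
        by (subst AE_iff_measurable[of "{1 / real (Suc n)..}"]) (auto simp: emeasure_eq_measure not_less)
      then have "AE x in P. \<forall>n. x < 1 / real (Suc n)" by (simp add: AE_all_countable)
      then have "AE x in P. x \<le> 0"
      proof eventually_elim
        case (elim x)
        show ?case
        proof (rule ccontr)
          assume "\<not> x \<le> 0"
          then obtain n where "inverse (real (Suc n)) < x" using reals_Archimedean[of x] by auto
          with elim[rule_format, of n] show False by (simp add: inverse_eq_divide)
        qed
      qed
      then have "(\<integral>x. x \<partial>P) \<le> 0" using integral_nonneg_AE[of "\<lambda>x. - x" P] by simp
      with pos show False by simp
    qed
    then show ?thesis using that by (auto simp: REV_def)
  qed
  have "\<forall>\<^sub>F x in at_top. g x < REV x0 P"
    using order_tendstoD(2)[OF lim, of "REV x0 P"] x0 by simp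
  then obtain K where K: "\<And>x. x \<ge> K \<Longrightarrow> g x < REV x0 P" by (auto simp: eventually_at_top_linorder)
  define S where "S = (\<lambda>x. REV x P) ` {0..max K x0}"
  have ne: "S \<noteq> {}" using x0 by (auto simp: S_def)
  have bdd: "bdd_above S"
  proof (rule bdd_aboveI)
    fix v assume "v \<in> S"
    then obtain x where "0 \<le> x" "x \<le> max K x0" "v = x * ?p x" by (auto simp: S_def REV_def)
    then show "v \<le> max K x0"
      using mult_left_le[of "?p x" x] prob_le_1[of "{x..}"] by linarith
  qed
  have outside: "REV x P \<le> Sup S" for x
  proof -
    have top: "REV x0 P \<le> Sup S" using x0 by (intro cSup_upper bdd) (auto simp: S_def)
    consider "x < 0" | "0 \<le> x" "x \<le> max K x0" | "0 \<le> x" "K \<le> x" by linarith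
    then show ?thesis
    proof cases
      case 1
      then have "REV x P \<le> 0" by (simp add: REV_def mult_nonpos_nonneg)
      then show ?thesis using top x0 by linarith
    next
      case 2
      then show ?thesis by (intro cSup_upper bdd) (auto simp: S_def)
    next
      case 3
      then show ?thesis using bound[of x] K[of x] top by linarith
    qed
  qed
  have "\<exists>x\<in>{0..max K x0}. Sup S - 1 / real (Suc n) < REV x P" for n
    using less_cSup_iff[OF ne bdd, of "Sup S - 1 / real (Suc n)"] by (auto simp: S_def)
  then obtain u where u: "\<And>n. u n \<in> {0..max K x0}" "\<And>n. Sup S - 1 / real (Suc n) < REV (u n) P"
    by metis
  obtain l \<sigma> where l: "l \<in> {0..max K x0}" "strict_mono (\<sigma> :: nat \<Rightarrow> nat)" "(u \<circ> \<sigma>) \<longlonglongrightarrow> l"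
    using compact_Icc[of 0 "max K x0"] u(1) unfolding compact_def by metis
  have step: "Sup S \<le> l * ?p (l - e)" if "0 < e" for e
  proof (rule LIMSEQ_le)
    show "(\<lambda>n. Sup S - 1 / real (Suc (\<sigma> n))) \<longlonglongrightarrow> Sup S"
    proof -
      have "(\<lambda>n. 1 / real (Suc n)) \<longlonglongrightarrow> 0"
        using LIMSEQ_inverse_real_of_nat by (simp add: inverse_eq_divide)
      from LIMSEQ_subseq_LIMSEQ[OF this l(2)] have "(\<lambda>n. 1 / real (Suc (\<sigma> n))) \<longlonglongrightarrow> 0"
        by (simp add: o_def)
      from tendsto_diff[OF tendsto_const this] show ?thesis by simp
    qed
    show "(\<lambda>n. u (\<sigma> n) * ?p (l - e)) \<longlonglongrightarrow> l * ?p (l - e)"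
      using l(3) by (intro tendsto_intros) (simp add: o_def)
    have "\<forall>\<^sub>F n in sequentially. l - e < u (\<sigma> n)"
      using order_tendstoD(1)[OF l(3), of "l - e"] that by simp
    then have "\<forall>\<^sub>F n in sequentially. Sup S - 1 / real (Suc (\<sigma> n)) \<le> u (\<sigma> n) * ?p (l - e)"
    proof eventually_elim
      case (elim n)
      have "?p (u (\<sigma> n)) \<le> ?p (l - e)" using elim by (intro finite_measure_mono) auto
      then have "REV (u (\<sigma> n)) P \<le> u (\<sigma> n) * ?p (l - e)"
        using u(1)[of "\<sigma> n"] unfolding REV_def by (intro mult_left_mono) auto
      with u(2)[of "\<sigma> n"] show ?case by linarith
    qed
    then show "\<exists>N. \<forall>n\<ge>N. Sup S - 1 / real (Suc (\<sigma> n)) \<le> u (\<sigma> n) * ?p (l - e)"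
      by (simp add: eventually_sequentially)
  qed
  have "(\<lambda>n. ?p (l - 1 / real (Suc n))) \<longlonglongrightarrow> measure P (\<Inter>n. {l - 1 / real (Suc n)..})"
  proof (rule finite_Lim_measure_decseq)
    show "decseq (\<lambda>n. {l - 1 / real (Suc n)..})"
      by (auto simp: decseq_def intro: order_trans[rotated] intro!: divide_left_mono)
  qed auto
  moreover have "(\<Inter>n. {l - 1 / real (Suc n)..}) = {l..}"
  proof (intro equalityI subsetI)
    fix x assume x: "x \<in> (\<Inter>n. {l - 1 / real (Suc n)..})"
    show "x \<in> {l..}"
    proof (rule ccontr)
      assume "x \<notin> {l..}"
      then obtain n where "inverse (real (Suc n)) < l - x" using reals_Archimedean[of "l - x"] by auto
      moreover have "l - 1 / real (Suc n) \<le> x" using x by auto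
      ultimately show False by (simp add: inverse_eq_divide)
    qed
  next
    fix x assume "x \<in> {l..}"
    then have "l - 1 / real (Suc n) \<le> x" for n
      by (rule_tac order_trans[of _ l]) auto
    then show "x \<in> (\<Inter>n. {l - 1 / real (Suc n)..})" by simp
  qed
  ultimately have "(\<lambda>n. l * ?p (l - 1 / real (Suc n))) \<longlonglongrightarrow> l * ?p l"
    by (intro tendsto_intros) simp
  then have "Sup S \<le> l * ?p l"
    by (rule LIMSEQ_le_const) (auto intro!: step)
  then have "REV x P \<le> REV l P" for x using outside[of x] by (simp add: REV_def[of l])
  then show ?thesis by blast
qed

lemma OPT_is_max:
  assumes "P \<in> ambiguity_set \<mu> s \<phi>" and "0 < \<mu>"
  shows "\<exists>r. OPT P = REV r P" and "REV r' P \<le> OPT P"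
proof -
  obtain r where r: "\<And>r'. REV r' P \<le> REV r P"
    using REV_attains_max[of P] assms by (auto simp: ambiguity_set_def)
  have "OPT P = REV r P"
    unfolding OPT_def by (rule Greatest_equality) (use r in auto)
  then show "\<exists>r. OPT P = REV r P" "REV r' P \<le> OPT P" using r by auto
qed

end

theory Submission
  imports Defs
begin

text \<open>A price \<open>x \<le> r\<close> earns at most \<open>r\<close>, since \<open>P(X \<ge> x) \<le> 1\<close>; a price \<open>x > r\<close> earns at most
  \<open>E(X; X \<ge> r)\<close>, by Markov's inequality on \<open>{X \<ge> r}\<close>. Divided by \<open>r P(X \<ge> r)\<close>, these bounds become
  \<open>1 / P(X \<ge> r)\<close> and \<open>E(X | X \<ge> r) / r\<close> (lemma \<open>OPT_REV_ratio_le\<close>). Everything therefore rests on how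
  small the tail mass and how large the conditional mean can be.

  Both extremes belong to the two-point distribution on \<open>r\<close> and \<open>v\<close> with mean \<open>\<mu>\<close> and
  \<open>\<phi>\<close>-moment \<open>s\<close>. Lemma \<open>tail_bounds\<close> shows this by linear-programming duality: supporting lines of
  \<open>\<phi>\<close> at \<open>r\<close> and at \<open>v\<close>, used to the left of \<open>r\<close> and from \<open>r\<close> onwards, form a piecewise
  linear minorant of \<open>\<phi>\<close>. Its expectation is at most \<open>s\<close>, it depends on \<open>P\<close> only through the tail
  mass and \<open>E(X; X \<ge> r)\<close>, and strict convexity turns the resulting inequality into both bounds.

  That extremal distribution sells at price \<open>r\<close> with certainty, because its atom at \<open>r\<close> lies
  inside \<open>{r..}\<close>, so the bounds are only approached: put the lower atom at \<open>a < r\<close> and let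
  \<open>a\<close> increase to \<open>r\<close>. For each \<open>a\<close> the upper atom is determined, since for fixed
  mean and lower atom the \<open>\<phi>\<close>-moment grows strictly with the upper atom, from 0 to infinity
  (\<open>two_point_mean_strict_mono\<close>, \<open>ex1_upper_point\<close>), and it depends continuously on \<open>a\<close> at \<open>r\<close>
  (\<open>upper_point_tendsto\<close>). Along this family the tail mass, the conditional mean and the revenue ratio
  converge simultaneously to their bounds, the ratio because selling at either atom already gives
  one of the two terms of the maximum (\<open>two_point_OPT_REV_ratio_ge\<close>).\<close>

section \<open>Strictly convex functions on the line\<close>

lemma strictly_convex_on_imp_convex_on:
  fixes f :: "real \<Rightarrow> real"
  assumes "strictly_convex_on S f"
  shows "convex_on S f"
proof (rule convex_onI)
  fix t :: real and x y assume "0 < t" "t < 1" "x \<in> S" "y \<in> S"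
  then show "f ((1 - t) *\<^sub>R x + t *\<^sub>R y) \<le> (1 - t) * f x + t * f y"
  proof (cases "x = y")
    case True
    then show ?thesis by (simp add: algebra_simps)
  next
    case False
    then show ?thesis
      using assms \<open>0 < t\<close> \<open>t < 1\<close> \<open>x \<in> S\<close> \<open>y \<in> S\<close>
      by (simp add: strictly_convex_on_def less_imp_le)
  qed
qed (use assms in \<open>auto simp: strictly_convex_on_def\<close>)

lemma strictly_convex_on_UNIV_continuous:
  assumes "strictly_convex_on UNIV f"
  shows "continuous_on UNIV f"
  using convex_on_continuous[OF open_UNIV] strictly_convex_on_imp_convex_on[OF assms] by blast

lemma strictly_convex_below_chord:
  assumes "strictly_convex_on UNIV f" "a < b" "b < c"
  shows "f b < f a + (b - a) / (c - a) * (f c - f a)"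
proof -
  define t where "t = (b - a) / (c - a)"
  have t: "0 < t" "t < 1" using assms by (auto simp: t_def)
  have "t * (c - a) = b - a" using assms by (simp add: t_def)
  then have b: "b = (1 - t) * a + t * c" by (simp add: algebra_simps)
  have "f ((1 - t) * a + t * c) < (1 - t) * f a + t * f c"
    using assms t by (auto simp: strictly_convex_on_def)
  then show ?thesis unfolding b[symmetric] t_def[symmetric] by (simp add: algebra_simps)
qed

text \<open>A supporting line that touched the graph at a second point would lie above it halfway between the
  two points of contact.\<close>

lemma strictly_convex_strict_subgradient:
  assumes "strictly_convex_on UNIV f" and sub: "\<And>x. f c + d * (x - c) \<le> f x" and "x \<noteq> c"
  shows "f c + d * (x - c) < f x"
proof -
  have *: "f ((1 - 1/2) * c + (1/2) * x) < (1 - 1/2) * f c + (1/2) * f x"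
    using assms(1,3) unfolding strictly_convex_on_def
    by (elim conjE) (drule bspec[of _ _ c], simp, drule bspec[of _ _ x], simp,
        drule spec[of _ "1/2"], simp)
  have "f c + d * (((1 - 1/2) * c + (1/2) * x) - c) \<le> f ((1 - 1/2) * c + (1/2) * x)"
    by (rule sub)
  with * show ?thesis by (simp add: algebra_simps)
qed

lemma convex_differentiable_subgradient:
  fixes f :: "real \<Rightarrow> real"
  assumes "convex_on UNIV f" "f differentiable (at c)"
  obtains d where "\<And>x. f c + d * (x - c) \<le> f x"
proof -
  obtain d where "(f has_real_derivative d) (at c)"
    using assms(2) real_differentiable_def by blast
  then have "f x - f c \<ge> d * (x - c)" for x
    using convex_on_imp_above_tangent[OF assms(1), of c x d] by auto
  then show ?thesis using that[of d] by (simp add: algebra_simps)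
qed

lemma superlinear_nonneg_eventually_ge:
  fixes f :: "real \<Rightarrow> real"
  assumes "filterlim (\<lambda>x. \<bar>f x / x\<bar>) at_top at_infinity" and "\<And>x. 0 \<le> f x"
  shows "\<forall>\<^sub>F x in at_top. K * x \<le> f x"
proof -
  have "filterlim (\<lambda>x. \<bar>f x / x\<bar>) at_top at_top"
    using assms(1) at_top_le_at_infinity filterlim_mono by blast
  then have "\<forall>\<^sub>F x in at_top. K \<le> \<bar>f x / x\<bar>" by (simp add: filterlim_at_top)
  then show ?thesis using eventually_gt_at_top[of 0]
  proof eventually_elim
    case (elim x)
    then show ?case using assms(2)[of x] by (simp add: field_simps)
  qed
qed

section \<open>Two-point distributions with a given mean\<close>

text \<open>The expectation of \<open>f\<close> under the distribution on \<open>a\<close> and \<open>b\<close> with mean \<open>\<mu>\<close>: these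
  two weights are the only ones that give mean \<open>\<mu>\<close>.\<close>

definition two_point_mean :: "real \<Rightarrow> (real \<Rightarrow> real) \<Rightarrow> real \<Rightarrow> real \<Rightarrow> real" where
  "two_point_mean \<mu> f a b = (b - \<mu>) / (b - a) * f a + (\<mu> - a) / (b - a) * f b"

text \<open>The value at \<open>\<mu>\<close> of the chord of \<open>f\<close> over \<open>[a, b]\<close>. In this form \<open>b\<close> enters only through the
  slope of the chord, which makes monotonicity and growth in \<open>b\<close> visible.\<close>

lemma two_point_mean_chord:
  assumes "a \<noteq> b"
  shows "two_point_mean \<mu> f a b = f a + (\<mu> - a) * ((f b - f a) / (b - a))"
proof -
  have "(b - \<mu>) / (b - a) = 1 - (\<mu> - a) / (b - a)" using assms by (simp add: field_simps)
  then show ?thesis by (simp add: two_point_mean_def algebra_simps diff_divide_distrib)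
qed

lemma two_point_mean_strict_mono:
  assumes "strictly_convex_on UNIV f" "a < \<mu>" "\<mu> < b" "b < c"
  shows "two_point_mean \<mu> f a b < two_point_mean \<mu> f a c"
proof -
  have "(f b - f a) / (b - a) < (f c - f a) / (c - a)"
    using strictly_convex_below_chord[OF assms(1), of a b c] assms by (simp add: field_simps)
  then have "(\<mu> - a) * ((f b - f a) / (b - a)) < (\<mu> - a) * ((f c - f a) / (c - a))"
    using assms by (intro mult_strict_left_mono) auto
  then show ?thesis using assms by (simp add: two_point_mean_chord)
qed

text \<open>At \<open>b = \<mu>\<close> the whole mass sits at \<open>\<mu>\<close> and the expectation is 0; superlinear growth makes the slope
  of the chord, hence the expectation, exceed any level for large \<open>b\<close>. In between, continuity gives
  existence and strict monotonicity gives uniqueness.\<close>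

lemma ex1_upper_point:
  assumes f: "strictly_convex_on UNIV f" and sup: "filterlim (\<lambda>x. \<bar>f x / x\<bar>) at_top at_infinity"
    and "f \<mu> = 0" and nonneg: "\<And>x. 0 \<le> f x" and "a < \<mu>" "0 < s"
  shows "\<exists>!b. \<mu> < b \<and> two_point_mean \<mu> f a b = s"
proof -
  \<comment> \<open>the slope that the chord from \<open>a\<close> must have in order to take the value \<open>s\<close> at \<open>\<mu>\<close>\<close>
  define T where "T = (s - f a) / (\<mu> - a)"
  have T: "s = f a + (\<mu> - a) * T" using \<open>a < \<mu>\<close> by (simp add: T_def)
  have "\<forall>\<^sub>F x in at_top. (\<bar>T\<bar> + 1) * x \<le> f x \<and> f a - T * a \<le> x \<and> 0 < x \<and> \<mu> < x"
    using superlinear_nonneg_eventually_ge[OF sup nonneg]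
    by (intro eventually_conj eventually_gt_at_top eventually_ge_at_top) auto
  then obtain c where c: "(\<bar>T\<bar> + 1) * c \<le> f c" "f a - T * a \<le> c" "0 < c" "\<mu> < c"
    by (metis (mono_tags, lifting) eventually_at_top_linorder order.refl)
  have "T * c \<le> \<bar>T\<bar> * c" using c by (intro mult_right_mono) auto
  moreover have "\<bar>T\<bar> * c + c \<le> f c" using c(1) by (simp add: algebra_simps)
  moreover have "T * (c - a) = T * c - T * a" by (simp add: algebra_simps)
  ultimately have "T * (c - a) \<le> f c - f a" using c by linarith
  then have "T \<le> (f c - f a) / (c - a)" using c \<open>a < \<mu>\<close> by (simp add: pos_le_divide_eq)
  then have "(\<mu> - a) * T \<le> (\<mu> - a) * ((f c - f a) / (c - a))"
    using \<open>a < \<mu>\<close> by (intro mult_left_mono) auto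
  then have hi: "s \<le> two_point_mean \<mu> f a c"
    using c \<open>a < \<mu>\<close> by (simp add: T two_point_mean_chord)
  have lo: "two_point_mean \<mu> f a \<mu> = 0" using assms by (simp add: two_point_mean_def)
  have "continuous_on {\<mu>..c} (\<lambda>b. two_point_mean \<mu> f a b)"
    unfolding two_point_mean_def using \<open>a < \<mu>\<close>
    by (intro continuous_intros continuous_on_subset[OF strictly_convex_on_UNIV_continuous[OF f]]) auto
  then obtain b where b: "\<mu> \<le> b" "two_point_mean \<mu> f a b = s"
    using IVT'[of "two_point_mean \<mu> f a" \<mu> s c] lo hi c \<open>0 < s\<close> by auto
  moreover have "b \<noteq> \<mu>" using b lo \<open>0 < s\<close> by auto
  ultimately have "\<mu> < b \<and> two_point_mean \<mu> f a b = s" by auto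
  then show ?thesis
    by (metis f \<open>a < \<mu>\<close> two_point_mean_strict_mono less_irrefl linorder_neqE_linordered_idom)
qed

text \<open>Moving the lower atom only slightly to the left of \<open>r\<close> cannot pull the upper atom down past a
  fixed \<open>c < v\<close>: with upper atom \<open>c\<close> the moment is below \<open>s\<close> at \<open>r\<close>, hence also nearby by
  continuity. An overshoot beyond \<open>v\<close> is excluded by hypothesis; for the family used here it is the bound
  on the conditional mean in \<open>tail_bounds\<close>.\<close>

lemma upper_point_tendsto:
  assumes f: "strictly_convex_on UNIV f" and r: "r < \<mu>"
    and V: "\<And>a. a < r \<Longrightarrow> \<mu> < V a \<and> two_point_mean \<mu> f a (V a) = s \<and> V a \<le> v"
    and v: "\<mu> < v" "two_point_mean \<mu> f r v = s"
  shows "(V \<longlongrightarrow> v) (at_left r)"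
proof (rule order_tendstoI)
  fix c assume "c < v"
  have left: "\<forall>\<^sub>F a in at_left r. a < r" by (simp add: eventually_at_filter)
  show "\<forall>\<^sub>F a in at_left r. c < V a"
  proof (cases "c \<le> \<mu>")
    case True
    show ?thesis using left by eventually_elim (use True V in force)
  next
    case False
    have lim: "((\<lambda>a. two_point_mean \<mu> f a c) \<longlongrightarrow> two_point_mean \<mu> f r c) (at_left r)"
    proof -
      have "isCont f r"
        using strictly_convex_on_UNIV_continuous[OF f] by (simp add: continuous_on_eq_continuous_at)
      then have "(f \<longlongrightarrow> f r) (at_left r)"
        by (meson continuous_at_imp_continuous_at_within continuous_within)
      then show ?thesis unfolding two_point_mean_def
        using False r by (intro tendsto_intros) auto
    qed
    have "two_point_mean \<mu> f r c < s"
      using two_point_mean_strict_mono[OF f r, of c v] False \<open>c < v\<close> v by auto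
    from order_tendstoD(2)[OF lim this] left show ?thesis
    proof eventually_elim
      case (elim a)
      show ?case
      proof (rule ccontr)
        assume "\<not> c < V a"
        then have "two_point_mean \<mu> f a (V a) \<le> two_point_mean \<mu> f a c"
          using two_point_mean_strict_mono[OF f, of a \<mu> "V a" c] V[OF elim(2)] elim r
          by (cases "V a = c") auto
        then show False using elim V[OF elim(2)] by linarith
      qed
    qed
  qed
next
  fix c assume "v < c"
  have left: "\<forall>\<^sub>F a in at_left r. a < r" by (simp add: eventually_at_filter)
  then show "\<forall>\<^sub>F a in at_left r. V a < c"
    by eventually_elim (use V \<open>v < c\<close> in force)
qed

text \<open>The two atoms exhaust the mass, so any integrand agrees almost everywhere with a combination of two
  indicators. Indicators as integrands recover the measure of every Borel set.\<close>

lemma (in real_distribution) two_atoms_integral: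
  fixes g :: "real \<Rightarrow> real"
  assumes "a \<noteq> b" and sum: "prob {a} + prob {b} = 1" and [measurable]: "g \<in> borel_measurable borel"
  shows "integrable M g" and "(\<integral>x. g x \<partial>M) = prob {a} * g a + prob {b} * g b"
proof -
  have "prob {a, b} = 1"
    using finite_measure_Union[of "{a}" "{b}"] assms by (simp add: insert_commute)
  then have "AE x in M. x \<in> {a, b}" by (subst (asm) prob_eq_1) auto
  then have eq: "AE x in M. g x = indicator {a} x * g a + indicator {b} x * g b"
    by eventually_elim (use assms in auto)
  have int: "integrable M (\<lambda>x. indicator {a} x * g a + indicator {b} x * g b)"
    by (simp add: less_top[symmetric])
  have [measurable]: "g \<in> borel_measurable M" using assms(3) by simp
  show "integrable M g"
    by (rule integrable_cong_AE_imp[OF int]) (use eq in auto)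
  have "(\<integral>x. g x \<partial>M) = (\<integral>x. indicator {a} x * g a + indicator {b} x * g b \<partial>M)"
    by (rule integral_cong_AE) (use eq in auto)
  then show "(\<integral>x. g x \<partial>M) = prob {a} * g a + prob {b} * g b"
    by (simp add: less_top[symmetric])
qed

lemma two_point_eqI:
  assumes P: "two_point \<mu> a b P" and Q: "two_point \<mu> a b Q"
    and mass: "measure P {a} = measure Q {a}"
  shows "P = Q"
proof -
  interpret P: real_distribution P using P by (simp add: two_point_def)
  interpret Q: real_distribution Q using Q by (simp add: two_point_def)
  have ab: "a \<noteq> b" using P by (auto simp: two_point_def)
  have sums: "measure P {a} + measure P {b} = 1" "measure Q {a} + measure Q {b} = 1"
    using P Q by (auto simp: two_point_def)
  show ?thesis
  proof (rule measure_eqI)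
    fix A assume "A \<in> sets P"
    then have [measurable]: "A \<in> sets borel" by simp
    have "measure P A = measure Q A"
      using P.two_atoms_integral(2)[OF ab sums(1), of "indicator A"]
        Q.two_atoms_integral(2)[OF ab sums(2), of "indicator A"] sums mass by simp
    then show "emeasure P A = emeasure Q A"
      by (simp add: P.emeasure_eq_measure Q.emeasure_eq_measure)
  qed simp
qed

lemma two_point_in_ambiguity_set_weights:
  assumes P: "two_point \<mu> a b P" and amb: "P \<in> ambiguity_set \<mu> s f"
    and [measurable]: "f \<in> borel_measurable borel"
  shows "measure P {a} = (b - \<mu>) / (b - a)" "measure P {b} = (\<mu> - a) / (b - a)"
    and "two_point_mean \<mu> f a b = s"
proof -
  interpret real_distribution P using P by (simp add: two_point_def)
  have ab: "a < \<mu>" "\<mu> < b" and sum: "prob {a} + prob {b} = 1" using P by (auto simp: two_point_def)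
  then have "a \<noteq> b" by auto
  note integral = two_atoms_integral(2)[OF this sum]
  have "prob {a} * a + prob {b} * b = \<mu>"
    using integral[of "\<lambda>x. x"] amb by (simp add: ambiguity_set_def)
  moreover have "prob {a} = 1 - prob {b}" using sum by simp
  ultimately have "prob {b} * (b - a) = \<mu> - a" by (simp add: algebra_simps)
  then show w: "prob {b} = (\<mu> - a) / (b - a)" using \<open>a \<noteq> b\<close> by (simp add: field_simps)
  with sum have "prob {a} = 1 - (\<mu> - a) / (b - a)" by simp
  then show w': "prob {a} = (b - \<mu>) / (b - a)" using \<open>a \<noteq> b\<close> by (simp add: field_simps)
  show "two_point_mean \<mu> f a b = s"
    using integral[of f] amb by (simp add: two_point_mean_def ambiguity_set_def w w')
qed

lemma two_point_in_ambiguity_set_unique: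
  assumes "two_point \<mu> a b P" "P \<in> ambiguity_set \<mu> s f" "two_point \<mu> a c Q" "Q \<in> ambiguity_set \<mu> s f"
    and f: "strictly_convex_on UNIV f"
  shows "P = Q"
proof -
  have [measurable]: "f \<in> borel_measurable borel"
    using strictly_convex_on_UNIV_continuous[OF f] by (rule borel_measurable_continuous_onI)
  have less: "a < \<mu>" "\<mu> < b" "\<mu> < c" using assms by (auto simp: two_point_def)
  have "two_point_mean \<mu> f a b = s" "two_point_mean \<mu> f a c = s"
    using two_point_in_ambiguity_set_weights(3) assms(1-4) by auto
  then have "b = c"
    using two_point_mean_strict_mono[OF f, of a \<mu> b c] two_point_mean_strict_mono[OF f, of a \<mu> c b] less
    by (cases b c rule: linorder_cases) auto
  then show ?thesis
    using two_point_eqI[of \<mu> a b P Q] two_point_in_ambiguity_set_weights(1) assms by auto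
qed

lemma ex_two_point_in_ambiguity_set:
  assumes ab: "a < \<mu>" "\<mu> < b" and s: "two_point_mean \<mu> f a b = s"
    and [measurable]: "f \<in> borel_measurable borel"
  shows "\<exists>P\<in>ambiguity_set \<mu> s f. two_point \<mu> a b P"
proof -
  define p where "p = (\<mu> - a) / (b - a)"
  have p: "0 < p" "p < 1" using ab by (auto simp: p_def)
  define P where "P = distr (measure_pmf (bernoulli_pmf p)) borel (\<lambda>h. if h then b else a)"
  interpret P: prob_space P unfolding P_def by (rule measure_pmf.prob_space_distr) simp
  have rd: "real_distribution P" by unfold_locales (auto simp: P_def)
  have int: "(\<integral>x. g x \<partial>P) = p * g b + (1 - p) * g a" if "g \<in> borel_measurable borel" for g :: "real \<Rightarrow> real"
    using p that by (simp add: P_def integral_distr integrable_measure_pmf_finite)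
  have masses: "measure P {a} = 1 - p" "measure P {b} = p"
    using int[of "indicator {a}"] int[of "indicator {b}"] ab by (auto simp: P_def)
  have tp: "two_point \<mu> a b P" using rd masses ab p by (auto simp: two_point_def)
  interpret P: real_distribution P by (rule rd)
  have integrable: "integrable P g" if "g \<in> borel_measurable borel" for g :: "real \<Rightarrow> real"
    using P.two_atoms_integral(1)[of a b g] that masses ab by auto
  have "1 - p = (b - \<mu>) / (b - a)" using ab by (simp add: p_def field_simps)
  then have "p * f b + (1 - p) * f a = s"
    using s by (simp add: two_point_mean_def p_def)
  moreover have "(\<integral>x. f x \<partial>P) = p * f b + (1 - p) * f a" by (rule int) simp
  ultimately have f: "(\<integral>x. f x \<partial>P) = s" by metis
  have "p * (b - a) = \<mu> - a" using ab by (simp add: p_def)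
  then have "p * b + (1 - p) * a = \<mu>" by (simp add: algebra_simps)
  moreover have "(\<integral>x. x \<partial>P) = p * b + (1 - p) * a" by (rule int) simp
  ultimately have mean: "(\<integral>x. x \<partial>P) = \<mu>" by metis
  have "integrable P f" "integrable P (\<lambda>x. x)" by (rule integrable; simp)+
  then have "P \<in> ambiguity_set \<mu> s f"
    using rd f mean by (simp add: ambiguity_set_def)
  then show ?thesis using tp by blast
qed

text \<open>A price strictly above the lower atom reaches only the buyer at the upper atom.\<close>

lemma two_point_tail:
  assumes P: "two_point \<mu> a b P" and r: "a < r" "r < \<mu>"
  shows "measure P {r..} = measure P {b}" "cond_mean_above P r = b"
    and "measure P {a..} = 1" "measure P {b..} = measure P {b}"
proof -
  interpret real_distribution P using P by (simp add: two_point_def)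
  have ab: "a < \<mu>" "\<mu> < b" "0 < prob {b}" and sum: "prob {a} + prob {b} = 1"
    using P by (auto simp: two_point_def)
  then have "a \<noteq> b" by auto
  note integral = two_atoms_integral(2)[OF this sum]
  have prob_eq: "prob A = prob {a} * indicator A a + prob {b} * indicator A b" if "A \<in> sets borel" for A
    using integral[of "indicator A"] that by simp
  show *: "prob {r..} = prob {b}" "prob {a..} = 1" "prob {b..} = prob {b}"
    using prob_eq[of "{r..}"] prob_eq[of "{a..}"] prob_eq[of "{b..}"] ab r sum by auto
  have "(\<integral>x\<in>{r..}. x \<partial>P) = prob {b} * b"
    using integral[of "\<lambda>x. indicator {r..} x *\<^sub>R x"] ab r
    by (simp add: set_lebesgue_integral_def indicator_def)
  then show "cond_mean_above P r = b" using ab * by (simp add: cond_mean_above_def)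
qed

section \<open>Extremal tail mass and conditional mean\<close>

text \<open>Write \<open>p\<close> for the tail mass, \<open>q\<close> for the mass of \<open>v\<close> under the two-point distribution on
  \<open>r\<close> and \<open>v\<close>, and \<open>u = E(X - v; X \<ge> r)\<close>. Integrating the piecewise linear minorant of \<open>f\<close> and
  subtracting the equation for \<open>s\<close> gives
  \<open>(p - q) (f v - f r - \<alpha> (v - r)) + (\<beta> - \<alpha>) u \<le> 0\<close>, where the two coefficients in front are
  positive by strict convexity. If \<open>q \<le> p\<close>, this forces \<open>u \<le> 0\<close>, which is the bound on the
  conditional mean. The case \<open>p < q\<close> is impossible: mass below \<open>r\<close> lies below \<open>r\<close>, so
  \<open>u \<ge> (q - p) (v - r)\<close>, and the left-hand side would be at least
  \<open>(q - p) (f r - f v - \<beta> (r - v)) > 0\<close>.\<close>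

lemma tail_bounds:
  assumes f: "strictly_convex_on UNIV f" and amb: "P \<in> ambiguity_set \<mu> s f"
    and r: "r < \<mu>" "\<mu> < v" and s: "two_point_mean \<mu> f r v = s"
    and r_sub: "\<And>x. f r + \<alpha> * (x - r) \<le> f x" and v_sub: "\<And>x. f v + \<beta> * (x - v) \<le> f x"
  shows "(\<mu> - r) / (v - r) \<le> measure P {r..}" and "cond_mean_above P r \<le> v"
proof -
  interpret real_distribution P using amb by (simp add: ambiguity_set_def)
  have int [simp]: "integrable P (\<lambda>x. x)" "integrable P f"
    and mean: "(\<integral>x. x \<partial>P) = \<mu>" "(\<integral>x. f x \<partial>P) = s"
    using amb by (auto simp: ambiguity_set_def)
  define p where "p = prob {r..}"
  define q where "q = (\<mu> - r) / (v - r)"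
  define U where "U = (\<integral>x. indicator {r..} x * x \<partial>P)"
  define u where "u = U - v * p"
  have intU [simp]: "integrable P (\<lambda>x. indicator {r..} x * x)"
    using integrable_mult_indicator[of "{r..}" P "\<lambda>x. x"] by simp
  have q: "q * (v - r) = \<mu> - r" using r by (simp add: q_def)
  have gap_r: "f r + \<alpha> * (v - r) < f v"
    using strictly_convex_strict_subgradient[OF f r_sub, of v] r by auto
  have gap_v: "f v + \<beta> * (r - v) < f r"
    using strictly_convex_strict_subgradient[OF f v_sub, of r] r by auto
  have "0 < (\<beta> - \<alpha>) * (v - r)" using gap_r gap_v by (simp add: algebra_simps)
  then have ba: "\<alpha> < \<beta>" using r by (simp add: zero_less_mult_iff)
  have "(\<integral>x. (f r - \<alpha> * r) + \<alpha> * x + indicator {r..} x * ((f v - \<beta> * v) - (f r - \<alpha> * r))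
            + (\<beta> - \<alpha>) * (indicator {r..} x * x) \<partial>P) \<le> (\<integral>x. f x \<partial>P)"
  proof (rule integral_mono)
    fix x
    show "(f r - \<alpha> * r) + \<alpha> * x + indicator {r..} x * ((f v - \<beta> * v) - (f r - \<alpha> * r))
            + (\<beta> - \<alpha>) * (indicator {r..} x * x) \<le> f x"
      using r_sub[of x] v_sub[of x] by (cases "x \<in> {r..}") (auto simp: algebra_simps)
  qed (auto simp: less_top[symmetric])
  then have dual: "(f r - \<alpha> * r) + \<alpha> * \<mu> + p * ((f v - \<beta> * v) - (f r - \<alpha> * r)) + (\<beta> - \<alpha>) * U \<le> s"
    by (simp add: mean p_def U_def prob_space[simplified] less_top[symmetric])
  have "0 \<le> (\<integral>x. (indicator {r..} x * x - indicator {r..} x * r) - (x - r) \<partial>P)"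
    by (rule integral_nonneg_AE) (auto simp: indicator_def)
  then have "0 \<le> (U - p * r) - (\<mu> - r)"
    by (simp add: mean p_def U_def prob_space[simplified] less_top[symmetric])
  then have below: "- (p - q) * (v - r) \<le> u" using q by (simp add: u_def algebra_simps)
  have "s = f r + q * (f v - f r)"
    using s r by (simp add: two_point_mean_chord q_def)
  moreover have "\<alpha> * (q * (v - r)) = \<alpha> * (\<mu> - r)" by (simp only: q)
  ultimately have dual': "(p - q) * (f v - f r - \<alpha> * (v - r)) + (\<beta> - \<alpha>) * u \<le> 0"
    using dual by (simp add: u_def algebra_simps)
  have pq: "q \<le> p"
  proof (rule ccontr)
    assume "\<not> q \<le> p"
    then have "0 < (p - q) * (f v - f r - \<beta> * (v - r))"
      using gap_v by (intro mult_neg_neg) (auto simp: algebra_simps)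
    moreover have "(\<beta> - \<alpha>) * (- (p - q) * (v - r)) \<le> (\<beta> - \<alpha>) * u"
      using below ba by (intro mult_left_mono) auto
    ultimately show False using dual' by (simp add: algebra_simps)
  qed
  then show "(\<mu> - r) / (v - r) \<le> prob {r..}" by (simp add: p_def q_def)
  have "0 \<le> (p - q) * (f v - f r - \<alpha> * (v - r))"
    using pq gap_r by (intro mult_nonneg_nonneg) auto
  then have "(\<beta> - \<alpha>) * u \<le> 0" using dual' by linarith
  then have "U \<le> v * p" using ba by (simp add: u_def mult_le_0_iff)
  moreover have "0 < p" using pq r by (smt (verit) q_def divide_pos_pos)
  ultimately show "cond_mean_above P r \<le> v"
    by (simp add: cond_mean_above_def set_lebesgue_integral_def U_def p_def pos_divide_le_eq)
qed

section \<open>Optimal revenue against the revenue at a fixed price\<close>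

lemma OPT_REV_ratio_le:
  assumes amb: "P \<in> ambiguity_set \<mu> s f" and "0 < \<mu>" "0 < r" and pos: "0 < measure P {r..}"
  shows "OPT P / REV r P \<le> max (1 / measure P {r..}) (cond_mean_above P r / r)"
proof -
  interpret real_distribution P using amb by (simp add: ambiguity_set_def)
  have [simp]: "integrable P (\<lambda>x. x)" using amb by (simp add: ambiguity_set_def)
  have [simp]: "integrable P (\<lambda>x. indicator {r..} x * x)"
    using integrable_mult_indicator[of "{r..}" P "\<lambda>x. x"] by simp
  obtain x where x: "OPT P = REV x P" using OPT_is_max(1)[OF amb \<open>0 < \<mu>\<close>] by blast
  show ?thesis
  proof (cases "x \<le> r")
    case True
    have "x * prob {x..} \<le> r"
    proof (cases "0 \<le> x")
      case True
      then show ?thesis using mult_left_mono[OF prob_le_1, of x "{x..}"] \<open>x \<le> r\<close> by simp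
    next
      case False
      then have "x * prob {x..} \<le> 0" by (intro mult_nonpos_nonneg) auto
      then show ?thesis using \<open>0 < r\<close> by linarith
    qed
    then have "OPT P / REV r P \<le> 1 / prob {r..}"
      unfolding x REV_def using pos \<open>0 < r\<close> by (simp add: field_simps)
    then show ?thesis by simp
  next
    case False
    have "x * prob {x..} = (\<integral>y. indicator {x..} y * x \<partial>P)" by simp
    also have "\<dots> \<le> (\<integral>y. indicator {r..} y * y \<partial>P)"
      by (rule integral_mono, simp add: less_top[symmetric], simp) (use False \<open>0 < r\<close> in \<open>auto simp: indicator_def\<close>)
    also have "\<dots> = cond_mean_above P r * prob {r..}"
      using pos by (simp add: cond_mean_above_def set_lebesgue_integral_def)
    finally have "OPT P / REV r P \<le> cond_mean_above P r / r"
      unfolding x REV_def using pos \<open>0 < r\<close> by (simp add: field_simps)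
    then show ?thesis by simp
  qed
qed

lemma two_point_OPT_REV_ratio_ge:
  assumes amb: "P \<in> ambiguity_set \<mu> s f" and P: "two_point \<mu> a b P" and "0 < r" "a < r" "r < \<mu>"
  shows "max (a / r * (1 / measure P {b})) (b / r) \<le> OPT P / REV r P"
proof -
  note tail = two_point_tail[OF P \<open>a < r\<close> \<open>r < \<mu>\<close>]
  have pos: "0 < measure P {b}" using P by (auto simp: two_point_def)
  have "REV a P \<le> OPT P" "REV b P \<le> OPT P" using OPT_is_max(2)[OF amb] assms by auto
  then show ?thesis using pos \<open>0 < r\<close> by (simp add: REV_def tail field_simps)
qed

text \<open>A bound that is approached along some family of members is the supremum, attained or not.\<close>

lemma SUP_ereal_eq_of_tendsto:
  fixes g :: "'a \<Rightarrow> real"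
  assumes "\<And>x. x \<in> A \<Longrightarrow> g x \<le> M" and "F \<noteq> bot" and "\<forall>\<^sub>F i in F. Q i \<in> A"
    and "((\<lambda>i. g (Q i)) \<longlongrightarrow> M) F"
  shows "(SUP x\<in>A. ereal (g x)) = ereal M"
proof (rule antisym)
  show "(SUP x\<in>A. ereal (g x)) \<le> ereal M" using assms(1) by (intro SUP_least) simp
  have "\<forall>\<^sub>F i in F. ereal (g (Q i)) \<le> (SUP x\<in>A. ereal (g x))"
    using assms(3) by eventually_elim (rule SUP_upper)
  then show "ereal M \<le> (SUP x\<in>A. ereal (g x))"
    using tendsto_upperbound[OF _ _ assms(2), of "\<lambda>i. ereal (g (Q i))"] assms(4) by simp
qed

lemma INF_ereal_eq_of_tendsto:
  fixes g :: "'a \<Rightarrow> real"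
  assumes "\<And>x. x \<in> A \<Longrightarrow> M \<le> g x" and "F \<noteq> bot" and "\<forall>\<^sub>F i in F. Q i \<in> A"
    and "((\<lambda>i. g (Q i)) \<longlongrightarrow> M) F"
  shows "(INF x\<in>A. ereal (g x)) = ereal M"
proof (rule antisym)
  show "ereal M \<le> (INF x\<in>A. ereal (g x))" using assms(1) by (intro INF_greatest) simp
  have "\<forall>\<^sub>F i in F. (INF x\<in>A. ereal (g x)) \<le> ereal (g (Q i))"
    using assms(3) by eventually_elim (rule INF_lower)
  then show "(INF x\<in>A. ereal (g x)) \<le> ereal M"
    using tendsto_lowerbound[OF _ _ assms(2), of "\<lambda>i. ereal (g (Q i))"] assms(4) by simp
qed

theorem proposition4p1:
  fixes \<mu> s r :: real and \<phi> :: "real \<Rightarrow> real"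
  assumes "0 < \<mu>" and "0 < s"
    and "strictly_convex_on UNIV \<phi>"
    and "\<And>x. x \<noteq> \<mu> \<Longrightarrow> \<phi> differentiable (at x)"
    and "filterlim (\<lambda>x. \<bar>\<phi> x / x\<bar>) at_top at_infinity"
    and "\<phi> \<mu> = 0"
    and "\<And>x. \<phi> \<mu> \<le> \<phi> x"
    and "0 < r" and "r < \<mu>"
  shows
    "(SUP P\<in>ambiguity_set \<mu> s \<phi>. ereal (OPT P / REV r P)) =
        max (1 / (INF P\<in>ambiguity_set \<mu> s \<phi>. ereal (measure P {r..})))
            ((SUP P\<in>ambiguity_set \<mu> s \<phi>. ereal (cond_mean_above P r)) / ereal r)
     \<and> (\<exists>v2. (\<mu> < v2 \<and> (v2 - \<mu>) / (v2 - r) * \<phi> r + (\<mu> - r) / (v2 - r) * \<phi> v2 = s)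
          \<and> (\<forall>v. \<mu> < v \<and> (v - \<mu>) / (v - r) * \<phi> r + (\<mu> - r) / (v - r) * \<phi> v = s \<longrightarrow> v = v2)
          \<and> (SUP P\<in>ambiguity_set \<mu> s \<phi>. ereal (OPT P / REV r P)) =
               ereal (max ((v2 - r) / (\<mu> - r)) (v2 / r))
          \<and> (\<exists>Q V.
               (\<forall>v1<r. Q v1 \<in> ambiguity_set \<mu> s \<phi> \<and> two_point \<mu> v1 (V v1) (Q v1) \<and>
                  (\<forall>P\<in>ambiguity_set \<mu> s \<phi>. (\<exists>v. two_point \<mu> v1 v P) \<longrightarrow> P = Q v1))
             \<and> (V \<longlongrightarrow> v2) (at_left r)
             \<and> ((\<lambda>v1. ereal (OPT (Q v1) / REV r (Q v1))) \<longlongrightarrow>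
                  (SUP P\<in>ambiguity_set \<mu> s \<phi>. ereal (OPT P / REV r P))) (at_left r)))"
proof -
  note f = assms(3) and r = assms(8,9)
  have nonneg: "0 \<le> \<phi> x" for x using assms(6,7) by simp
  have [measurable]: "\<phi> \<in> borel_measurable borel"
    using strictly_convex_on_UNIV_continuous[OF f] by (rule borel_measurable_continuous_onI)
  note ex1 = ex1_upper_point[OF f assms(5,6) nonneg _ assms(2)]
  obtain v where v: "\<mu> < v" "two_point_mean \<mu> \<phi> r v = s"
    and v_unique: "\<And>b. \<mu> < b \<Longrightarrow> two_point_mean \<mu> \<phi> r b = s \<Longrightarrow> b = v"
    using ex1[OF r(2)] by blast
  let ?A = "ambiguity_set \<mu> s \<phi>"
  let ?p = "(\<mu> - r) / (v - r)"
  let ?M = "max ((v - r) / (\<mu> - r)) (v / r)"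
  obtain \<alpha> \<beta> where "\<And>x. \<phi> r + \<alpha> * (x - r) \<le> \<phi> x" "\<And>x. \<phi> v + \<beta> * (x - v) \<le> \<phi> x"
    using convex_differentiable_subgradient[OF strictly_convex_on_imp_convex_on[OF f] assms(4)] r v
    by (metis less_irrefl)
  note bounds = tail_bounds[OF f _ r(2) v this]
  have p: "0 < ?p" using r v by simp
  have upper: "OPT P / REV r P \<le> ?M" if P: "P \<in> ?A" for P
  proof -
    have pos: "0 < measure P {r..}" using bounds(1)[OF P] p by linarith
    have "1 / measure P {r..} \<le> 1 / ?p" by (rule frac_le) (rule bounds(1)[OF P] | fact p | simp)+
    moreover have "cond_mean_above P r / r \<le> v / r"
      using bounds(2)[OF P] r by (simp add: divide_right_mono)
    ultimately have "max (1 / measure P {r..}) (cond_mean_above P r / r) \<le> ?M"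
      by (intro max.mono) auto
    then show ?thesis using OPT_REV_ratio_le[OF P assms(1) r(1) pos] by linarith
  qed

  have "\<exists>b Q. \<mu> < b \<and> two_point_mean \<mu> \<phi> a b = s \<and> Q \<in> ?A \<and> two_point \<mu> a b Q" if "a < r" for a
  proof -
    have "a < \<mu>" using that r by simp
    then obtain b where b: "\<mu> < b" "two_point_mean \<mu> \<phi> a b = s" using ex1[of a] by blast
    then obtain Q where "Q \<in> ?A" "two_point \<mu> a b Q"
      using ex_two_point_in_ambiguity_set[OF \<open>a < \<mu>\<close>, of b \<phi> s] by auto
    then show ?thesis using b by blast
  qed
  then obtain V Q where VQ: "\<And>a. a < r \<Longrightarrow> \<mu> < V a \<and> two_point_mean \<mu> \<phi> a (V a) = s"
      "\<And>a. a < r \<Longrightarrow> Q a \<in> ?A" "\<And>a. a < r \<Longrightarrow> two_point \<mu> a (V a) (Q a)"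
    by metis
  note tail = two_point_tail[OF VQ(3) _ r(2)]
  have left: "\<forall>\<^sub>F a in at_left r. a < r" by (simp add: eventually_at_filter)
  have Q_in: "\<forall>\<^sub>F a in at_left r. Q a \<in> ?A" using left by eventually_elim (rule VQ)
  \<comment> \<open>the upper atom of \<open>Q a\<close> is its conditional mean above \<open>r\<close>\<close>
  have V_le: "V a \<le> v" if "a < r" for a using bounds(2)[OF VQ(2)] tail(2) that by simp
  have V_lim: "(V \<longlongrightarrow> v) (at_left r)"
    by (rule upper_point_tendsto[OF f r(2) _ v]) (use VQ V_le in auto)
  have tail_eq: "measure (Q a) {r..} = (\<mu> - a) / (V a - a)" if "a < r" for a
    using tail(1) two_point_in_ambiguity_set_weights(2)[OF VQ(3) VQ(2)] that by simp
  have "((\<lambda>a. (\<mu> - a) / (V a - a)) \<longlongrightarrow> ?p) (at_left r)"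
    using r v by (intro tendsto_intros V_lim) auto
  then have tail_lim: "((\<lambda>a. measure (Q a) {r..}) \<longlongrightarrow> ?p) (at_left r)"
    by (rule Lim_transform_eventually) (use left in eventually_elim, simp add: tail_eq)
  have mean_lim: "((\<lambda>a. cond_mean_above (Q a) r) \<longlongrightarrow> v) (at_left r)"
    by (rule Lim_transform_eventually[OF V_lim]) (use left in eventually_elim, simp add: tail)
  \<comment> \<open>selling at the lower atom loses only the factor \<open>a / r\<close>, which tends to 1\<close>
  have ratio_lim: "((\<lambda>a. OPT (Q a) / REV r (Q a)) \<longlongrightarrow> ?M) (at_left r)"
  proof (rule tendsto_sandwich)
    show "\<forall>\<^sub>F a in at_left r. max (a / r * (1 / measure (Q a) {r..})) (V a / r) \<le> OPT (Q a) / REV r (Q a)"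
      using left
    proof eventually_elim
      case (elim a)
      then show ?case
        using two_point_OPT_REV_ratio_ge[OF VQ(2,3) r(1) _ r(2)] tail(1) by simp
    qed
    show "\<forall>\<^sub>F a in at_left r. OPT (Q a) / REV r (Q a) \<le> ?M"
      using Q_in by eventually_elim (rule upper)
    have "((\<lambda>a. max (a / r * (1 / measure (Q a) {r..})) (V a / r))
            \<longlongrightarrow> max (r / r * (1 / ?p)) (v / r)) (at_left r)"
      using p r by (intro tendsto_intros tail_lim V_lim) auto
    then show "((\<lambda>a. max (a / r * (1 / measure (Q a) {r..})) (V a / r)) \<longlongrightarrow> ?M) (at_left r)"
      using r by simp
  qed simp

  have nb: "at_left r \<noteq> bot" by simp
  have sup: "(SUP P\<in>?A. ereal (OPT P / REV r P)) = ereal ?M"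
    by (rule SUP_ereal_eq_of_tendsto[OF upper nb Q_in ratio_lim])
  have inf: "(INF P\<in>?A. ereal (measure P {r..})) = ereal ?p"
    by (rule INF_ereal_eq_of_tendsto[OF bounds(1) nb Q_in tail_lim])
  have mean: "(SUP P\<in>?A. ereal (cond_mean_above P r)) = ereal v"
    by (rule SUP_ereal_eq_of_tendsto[OF bounds(2) nb Q_in mean_lim])
  have "1 / ereal ?p = ereal ((v - r) / (\<mu> - r))" using r v by (simp add: one_ereal_def)
  moreover have "ereal v / ereal r = ereal (v / r)" using r by simp
  ultimately have max_eq: "max (1 / ereal ?p) (ereal v / ereal r) = ereal ?M"
    by (simp add: ereal_max)
  have v_eq: "\<mu> < v \<and> (v - \<mu>) / (v - r) * \<phi> r + (\<mu> - r) / (v - r) * \<phi> v = s"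
    using v by (simp add: two_point_mean_def)
  have v_unique': "\<forall>b. \<mu> < b \<and> (b - \<mu>) / (b - r) * \<phi> r + (\<mu> - r) / (b - r) * \<phi> b = s \<longrightarrow> b = v"
    using v_unique by (simp add: two_point_mean_def)
  have Q: "\<forall>a<r. Q a \<in> ?A \<and> two_point \<mu> a (V a) (Q a) \<and>
      (\<forall>P\<in>?A. (\<exists>b. two_point \<mu> a b P) \<longrightarrow> P = Q a)"
    using VQ(2,3) two_point_in_ambiguity_set_unique[OF _ _ VQ(3) VQ(2) f] by blast
  have ratio_lim': "((\<lambda>a. ereal (OPT (Q a) / REV r (Q a))) \<longlongrightarrow> ereal ?M) (at_left r)"
    using ratio_lim by (rule tendsto_ereal)
  show ?thesis
    unfolding sup inf mean max_eq
    by (intro conjI refl exI[of _ v] exI[of _ Q] exI[of _ V])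
      (rule v_eq[THEN conjunct1] v_eq[THEN conjunct2] v_unique' Q V_lim ratio_lim')+
qed

end
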